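(* Let $H\leq\operatorname{Aut}\mathcal{T}_2$ be the group generated by $\sigma$ and $x$, where $\sigma$ is the rooted automorphism of the binary tree $\mathcal{T}_2$ corresponding to $(1\,2)$ and $x=(1,x)\sigma$ is the adding machine. Then $H$ (which is a subgroup of $\Gamma=\operatorname{Aut}\mathcal{T}_2$) is not fractal, $|H':\mathrm{st}_H(1)'|=\infty$, and $L(H)=\mathrm{st}_H(1)$.
   Context: Automorphisms act on the right. For a group $G$, $G'$ is the derived subgroup, $[x,y]=x^{-1}y^{-1}xy$, $[x,_1y]=[x,y]$, $[x,_ny]=[[x,_{n-1}y],y]$ for $n\ge 2$. An element $g\in G$ is left Engel if for every $x\in G$ there is $n=n(g,x)\ge1$ with $[x,_ng]=1$; $L(G)$ denotes the set of left Engel elements of $G$. $\mathcal{T}_2$ is the rooted binary tree; $\mathrm{st}(1)$ is the subgroup of $\operatorname{Aut}\mathcal{T}_2$ fixing both first-level vertices, and $\mathrm{st}_G(1)=\mathrm{st}(1)\cap G$. $\psi:\mathrm{st}(1)\to\operatorname{Aut}\mathcal{T}_2\times\operatorname{Aut}\mathcal{T}_2$ is the isomorphism sending $g$ to the pair of its sections at the first-level vertices (its actions on the two subtrees hanging from them, identified with $\mathcal{T}_2$). The rooted automorphism $\sigma$ rigidly swaps these two subtrees. The notation $(g_1,g_2)\sigma$ means $\psi^{-1}(g_1,g_2)\cdot\sigma$. Every $g\in\operatorname{Aut}\mathcal{T}_2$ is uniquely $g=g_0\tau$ with $g_0\in\mathrm{st}(1)$, $\tau\in\{1,\sigma\}$;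 $G\le\operatorname{Aut}\mathcal{T}_2$ is self-similar if $\psi(g_0)\in G\times G$ for all $g=g_0\tau\in G$, and it is fractal if moreover both projections of $\psi(\mathrm{st}_G(1))$ to $G$ are onto. $\Gamma\le \operatorname{Aut}\mathcal{T}_p$ denotes the group of automorphisms whose local permutation at each vertex is a power of $(1\,2\,\dots\,p)$ (standard Sylow pro-$p$ subgroup); for $p=2$ it equals $\operatorname{Aut}\mathcal{T}_2$. *)

theory Defs
  imports "HOL-Algebra.Generated_Groups"
begin

text \<open>Vertices of the rooted binary tree are finite words over the alphabet bool, the root is the
  empty word, and the children of v are v @ [False] (first) and v @ [True] (second).\<close>

definition tree_edge :: "bool list \<Rightarrow> bool list \<Rightarrow> bool" where
  "tree_edge u v \<longleftrightarrow> (\<exists>a. v = u @ [a] \<or> u = v @ [a])"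

definition tree_aut :: "(bool list \<Rightarrow> bool list) set" where
  "tree_aut = {g. bij g \<and> g [] = [] \<and> (\<forall>u v. tree_edge (g u) (g v) \<longleftrightarrow> tree_edge u v)}"

text \<open>Automorphisms act on the right, so the product of g and h applies g first.\<close>

definition AutT2 :: "(bool list \<Rightarrow> bool list) monoid" where
  "AutT2 = \<lparr>carrier = tree_aut, mult = (\<lambda>g h. h \<circ> g), one = id\<rparr>"

definition st1 :: "(bool list \<Rightarrow> bool list) set" where
  "st1 = {g \<in> carrier AutT2. \<forall>a. g [a] = [a]}"

definition section_at :: "(bool list \<Rightarrow> bool list) \<Rightarrow> bool list \<Rightarrow> bool list \<Rightarrow> bool list" where
  "section_at g v = (\<lambda>w. drop (length v) (g (v @ w)))"

definition psi :: "(bool list \<Rightarrow> bool list) \<Rightarrow> (bool list \<Rightarrow> bool list) \<times> (bool list \<Rightarrow> bool list)" where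
  "psi g = (section_at g [False], section_at g [True])"

definition sigma :: "bool list \<Rightarrow> bool list" where
  "sigma w = (case w of [] \<Rightarrow> [] | a # u \<Rightarrow> (\<not> a) # u)"

text \<open>The recursion x = (1,x)sigma with products read from left to right; see the lemma
  \<open>adding_machine_iff\<close> below.\<close>

primrec adding_machine :: "bool list \<Rightarrow> bool list" where
  "adding_machine [] = []"
| "adding_machine (a # w) = (if a then False # adding_machine w else True # w)"

definition local_perm :: "(bool list \<Rightarrow> bool list) \<Rightarrow> bool list \<Rightarrow> bool \<Rightarrow> bool" where
  "local_perm g v = (\<lambda>a. last (g (v @ [a])))"

text \<open>The case p = 2 of the group of automorphisms whose local permutations are all powers of the
  cycle (1 2 ... p); on the alphabet bool this cycle is Not.\<close>

definition Gamma2 :: "(bool list \<Rightarrow> bool list) monoid" where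
  "Gamma2 = AutT2\<lparr>carrier := {g \<in> carrier AutT2. \<forall>v. \<exists>k. local_perm g v = Not ^^ k}\<rparr>"

definition self_similar :: "(bool list \<Rightarrow> bool list) set \<Rightarrow> bool" where
  "self_similar G \<longleftrightarrow>
     (\<forall>g0\<in>st1. \<forall>t\<in>{\<one>\<^bsub>AutT2\<^esub>, sigma}. g0 \<otimes>\<^bsub>AutT2\<^esub> t \<in> G \<longrightarrow> psi g0 \<in> G \<times> G)"

definition fractal :: "(bool list \<Rightarrow> bool list) set \<Rightarrow> bool" where
  "fractal G \<longleftrightarrow> self_similar G \<and>
     fst ` psi ` (st1 \<inter> G) = G \<and> snd ` psi ` (st1 \<inter> G) = G"

definition commutator :: "('a, 'b) monoid_scheme \<Rightarrow> 'a \<Rightarrow> 'a \<Rightarrow> 'a" where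
  "commutator G x y = inv\<^bsub>G\<^esub> x \<otimes>\<^bsub>G\<^esub> inv\<^bsub>G\<^esub> y \<otimes>\<^bsub>G\<^esub> x \<otimes>\<^bsub>G\<^esub> y"

primrec engel_commutator :: "('a, 'b) monoid_scheme \<Rightarrow> 'a \<Rightarrow> nat \<Rightarrow> 'a \<Rightarrow> 'a" where
  "engel_commutator G x 0 y = x"
| "engel_commutator G x (Suc n) y = commutator G (engel_commutator G x n y) y"

definition left_engel_elements :: "('a, 'b) monoid_scheme \<Rightarrow> 'a set" where
  "left_engel_elements G =
     {g \<in> carrier G. \<forall>x\<in>carrier G. \<exists>n\<ge>1. engel_commutator G x n g = \<one>\<^bsub>G\<^esub>}"

definition infinite_index :: "('a, 'b) monoid_scheme \<Rightarrow> 'a set \<Rightarrow> 'a set \<Rightarrow> bool" where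
  "infinite_index G A B \<longleftrightarrow>
     subgroup B (G\<lparr>carrier := A\<rparr>) \<and> infinite (rcosets\<^bsub>G\<lparr>carrier := A\<rparr>\<^esub> B)"

lemma tree_aut_snoc:
  assumes "g \<in> tree_aut"
  shows "\<exists>b. g (v @ [a]) = g v @ [b]"
proof (induction v arbitrary: a rule: rev_induct)
  case Nil
  have "tree_edge [] [a]"
    by (simp add: tree_edge_def)
  then have "tree_edge (g []) (g [a])"
    using assms unfolding tree_aut_def by blast
  moreover have "g [] = []"
    using assms by (simp add: tree_aut_def)
  ultimately show ?case
    by (simp add: tree_edge_def)
next
  case (snoc c u)
  obtain d where d: "g (u @ [c]) = g u @ [d]" using snoc by blast
  have "tree_edge (u @ [c]) ((u @ [c]) @ [a])"
    by (simp add: tree_edge_def)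
  then have "tree_edge (g (u @ [c])) (g ((u @ [c]) @ [a]))"
    using assms by (simp add: tree_aut_def)
  moreover have "g u \<noteq> g (u @ [c, a])"
    using assms by (simp add: tree_aut_def bij_is_inj inj_eq)
  ultimately show ?case
    using d by (auto simp: tree_edge_def)
qed

lemma tree_aut_prefix:
  assumes "g \<in> tree_aut"
  shows "\<exists>w'. g (v @ w) = g v @ w' \<and> length w' = length w"
proof (induction w rule: rev_induct)
  case (snoc a w)
  then show ?case
    using tree_aut_snoc[OF assms, of "v @ w" a] by force
qed simp

lemma group_AutT2: "group AutT2"
proof (rule groupI)
  fix g assume g: "g \<in> carrier AutT2"
  have b: "bij g" "g [] = []" and e: "\<And>u v. tree_edge (g u) (g v) \<longleftrightarrow> tree_edge u v"
    using g by (simp_all add: AutT2_def tree_aut_def)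
  have "tree_edge (inv_into UNIV g u) (inv_into UNIV g v) \<longleftrightarrow> tree_edge u v" for u v
    using e[of "inv_into UNIV g u" "inv_into UNIV g v"] b by (simp add: bij_is_surj surj_f_inv_f)
  moreover have "inv_into UNIV g [] = []"
    using b by (simp add: bij_is_inj inv_f_eq)
  ultimately have "inv_into UNIV g \<in> tree_aut"
    using b by (simp add: tree_aut_def bij_imp_bij_inv)
  moreover have "g \<circ> inv_into UNIV g = id"
    using b by (simp add: fun_eq_iff bij_is_surj surj_f_inv_f)
  ultimately show "\<exists>h\<in>carrier AutT2. h \<otimes>\<^bsub>AutT2\<^esub> g = \<one>\<^bsub>AutT2\<^esub>"
    by (auto simp: AutT2_def)
qed (auto simp: AutT2_def tree_aut_def bij_comp comp_assoc)

lemma st1_Cons: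
  assumes "g \<in> st1"
  shows "g (a # w) = a # section_at g [a] w"
  using assms tree_aut_prefix[of g "[a]" w] by (auto simp: st1_def AutT2_def section_at_def)

lemma inj_on_psi: "inj_on psi st1"
proof (rule inj_onI, rule ext)
  fix g h w assume gh: "g \<in> st1" "h \<in> st1" "psi g = psi h"
  show "g w = h w"
  proof (cases w)
    case Nil
    then show ?thesis using gh by (simp add: st1_def AutT2_def tree_aut_def)
  next
    case (Cons a u)
    then show ?thesis using gh by (cases a) (simp_all add: st1_Cons psi_def)
  qed
qed

definition pair_aut :: "(bool list \<Rightarrow> bool list) \<Rightarrow> (bool list \<Rightarrow> bool list) \<Rightarrow> bool list \<Rightarrow> bool list" where
  "pair_aut g h w = (case w of [] \<Rightarrow> [] | a # u \<Rightarrow> a # (if a then h else g) u)"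

lemma tree_edge_simps:
  "tree_edge [] v \<longleftrightarrow> (\<exists>a. v = [a])"
  "tree_edge v [] \<longleftrightarrow> (\<exists>a. v = [a])"
  "tree_edge (a # u) (b # v) \<longleftrightarrow> a = b \<and> tree_edge u v"
  by (auto simp: tree_edge_def Cons_eq_append_conv)

lemma tree_aut_eq_Nil: "g \<in> tree_aut \<Longrightarrow> g v = [] \<longleftrightarrow> v = []"
  using inj_eq[of g v "[]"] by (simp add: tree_aut_def bij_is_inj)

lemma pair_aut_st1:
  assumes "g \<in> tree_aut" "h \<in> tree_aut"
  shows "pair_aut g h \<in> st1"
proof -
  have "bij (pair_aut g h)"
  proof (rule o_bij)
    show "pair_aut (inv_into UNIV g) (inv_into UNIV h) \<circ> pair_aut g h = id"
      using assms by (auto simp: fun_eq_iff pair_aut_def tree_aut_def bij_is_inj split: list.split)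
    show "pair_aut g h \<circ> pair_aut (inv_into UNIV g) (inv_into UNIV h) = id"
      using assms
      by (auto simp: fun_eq_iff pair_aut_def tree_aut_def bij_is_surj surj_f_inv_f split: list.split)
  qed
  moreover have "tree_edge (pair_aut g h u) (pair_aut g h v) \<longleftrightarrow> tree_edge u v" for u v
    using assms tree_aut_eq_Nil[OF assms(1)] tree_aut_eq_Nil[OF assms(2)]
    by (cases u; cases v) (simp_all add: pair_aut_def tree_edge_simps tree_aut_def)
  ultimately show ?thesis
    using assms by (simp add: st1_def AutT2_def tree_aut_def pair_aut_def)
qed

lemma psi_pair_aut: "psi (pair_aut g h) = (g, h)"
  by (simp add: psi_def section_at_def pair_aut_def)

lemma section_at_tree_aut:
  assumes "g \<in> st1"
  shows "section_at g [a] \<in> tree_aut"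
proof -
  have g: "bij g" "g [] = []" "\<And>u v. tree_edge (g u) (g v) \<longleftrightarrow> tree_edge u v" "g [a] = [a]"
    using assms by (auto simp: st1_def AutT2_def tree_aut_def)
  note C = st1_Cons[OF assms]
  have "inj (section_at g [a])"
  proof (rule injI)
    fix u v assume "section_at g [a] u = section_at g [a] v"
    then have "g (a # u) = g (a # v)" by (simp add: C)
    then show "u = v" using g(1) by (simp add: bij_is_inj inj_eq)
  qed
  moreover have "\<exists>u. section_at g [a] u = w" for w
  proof -
    obtain v where v: "g v = a # w" using g(1) by (metis bij_pointE)
    then show ?thesis using g(2) C by (cases v) auto
  qed
  moreover have "tree_edge (section_at g [a] u) (section_at g [a] v) \<longleftrightarrow> tree_edge u v" for u v
    using g(3)[of "a # u" "a # v"] by (simp add: C tree_edge_simps)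
  ultimately show ?thesis
    using g(4) C[of a "[]"] unfolding tree_aut_def bij_def surj_def by auto metis
qed

lemma bij_betw_psi: "bij_betw psi st1 (carrier AutT2 \<times> carrier AutT2)"
proof -
  have "psi ` st1 = tree_aut \<times> tree_aut"
  proof
    show "psi ` st1 \<subseteq> tree_aut \<times> tree_aut"
      by (auto simp: psi_def section_at_tree_aut)
    show "tree_aut \<times> tree_aut \<subseteq> psi ` st1"
    proof clarify
      fix g h assume "g \<in> tree_aut" "h \<in> tree_aut"
      then show "(g, h) \<in> psi ` st1"
        using pair_aut_st1[of g h] psi_pair_aut[of g h] by (metis imageI)
    qed
  qed
  then show ?thesis
    using inj_on_psi by (simp add: bij_betw_def AutT2_def)
qed

lemma inv_psi:
  assumes "g \<in> carrier AutT2" "h \<in> carrier AutT2"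
  shows "inv_into st1 psi (g, h) = pair_aut g h"
proof -
  have "pair_aut g h \<in> st1" using assms by (simp add: AutT2_def pair_aut_st1)
  then show ?thesis using inv_into_f_f[OF inj_on_psi] by (metis psi_pair_aut)
qed

lemma sigma_aut: "sigma \<in> carrier AutT2"
proof -
  have "bij sigma"
    by (rule o_bij[of sigma]) (simp_all add: sigma_def fun_eq_iff split: list.split)
  moreover have "tree_edge (sigma u) (sigma v) \<longleftrightarrow> tree_edge u v" for u v
    by (cases u; cases v) (auto simp: sigma_def tree_edge_simps)
  ultimately show ?thesis
    by (simp add: AutT2_def tree_aut_def sigma_def)
qed

lemma adding_machine_aut: "adding_machine \<in> carrier AutT2"
proof -
  have len: "length (adding_machine w) = length w" for w by (induction w) auto
  have inj: "adding_machine u = adding_machine v \<Longrightarrow> u = v" for u v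
  proof (induction u arbitrary: v)
    case Nil
    then show ?case using len[of v] by simp
  next
    case (Cons a u)
    then show ?case by (cases v) (auto split: if_splits)
  qed
  have surj: "\<exists>u. adding_machine u = v" for v
  proof (induction v)
    case Nil
    show ?case by (rule exI[of _ "[]"]) simp
  next
    case (Cons a v)
    then obtain u where u: "adding_machine u = v" by blast
    show ?case
      by (cases a) (use u in \<open>auto intro: exI[of _ "False # v"] exI[of _ "True # u"]\<close>)
  qed
  have one: "(\<exists>b. adding_machine v = [b]) \<longleftrightarrow> (\<exists>b. v = [b])" for v
    using len[of v] by (cases v; cases "adding_machine v") auto
  have edge: "tree_edge (adding_machine u) (adding_machine v) \<longleftrightarrow> tree_edge u v" for u v
  proof (induction u arbitrary: v)
    case Nil
    show ?case using one[of v] by (simp only: adding_machine.simps(1) tree_edge_simps)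
  next
    case (Cons a u)
    show ?case
    proof (cases v)
      case Nil
      then show ?thesis using one[of "a # u"] by (simp only: adding_machine.simps(1) tree_edge_simps)
    next
      case v: (Cons b w)
      show ?thesis using Cons.IH by (auto simp: v tree_edge_simps)
    qed
  qed
  show ?thesis
    using inj surj edge unfolding AutT2_def tree_aut_def bij_def inj_def surj_def by auto metis
qed

lemma adding_machine_iff:
  assumes x: "x \<in> carrier AutT2"
  shows "x = inv_into st1 psi (\<one>\<^bsub>AutT2\<^esub>, x) \<otimes>\<^bsub>AutT2\<^esub> sigma \<longleftrightarrow> x = adding_machine"
proof -
  have id: "id \<in> carrier AutT2" by (simp add: AutT2_def tree_aut_def)
  have prod: "inv_into st1 psi (\<one>\<^bsub>AutT2\<^esub>, y) \<otimes>\<^bsub>AutT2\<^esub> sigma = sigma \<circ> pair_aut id y"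
    if "y \<in> carrier AutT2" for y
    using inv_psi[OF id that] by (simp add: AutT2_def)
  have "x = adding_machine" if eq: "x = sigma \<circ> pair_aut id x"
  proof
    fix w show "x w = adding_machine w"
    proof (induction w)
      case Nil
      show ?case using fun_cong[OF eq, of "[]"] by (simp add: sigma_def pair_aut_def)
    next
      case (Cons a w)
      then show ?case using fun_cong[OF eq, of "a # w"] by (simp add: sigma_def pair_aut_def)
    qed
  qed
  moreover have "adding_machine = sigma \<circ> pair_aut id adding_machine"
    by (auto simp: fun_eq_iff sigma_def pair_aut_def split: list.split)
  ultimately show ?thesis using prod[OF x] by auto
qed

end

theory Submission
  imports Defs
begin

text \<open>Since \<open>x\<sigma> = (1,x)\<close> and \<open>\<sigma>x = (x,1)\<close>, the group \<open>H\<close> consists of the elements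
  \<open>(x\<^sup>i,x\<^sup>j)\<close> and \<open>(x\<^sup>i,x\<^sup>j)\<sigma>\<close>. As \<open>x\<^sup>2 = (x,x)\<close>, a descent on the exponent shows that \<open>x\<close> has
  infinite order, so \<open>H\<close> is the wreath product of an infinite cyclic group with a group of order two,
  with base group \<open>st\<^sub>H(1)\<close>. The base is abelian and normal, hence consists of Engel elements and has
  trivial derived subgroup, while \<open>H'\<close> contains all \<open>(x\<^sup>i,x\<^sup>-\<^sup>i)\<close>. Commutation with an element outside
  the base maps \<open>(x\<^sup>i,x\<^sup>-\<^sup>i)\<close> to \<open>(x\<^sup>-\<^sup>2\<^sup>i,x\<^sup>2\<^sup>i)\<close>, which never reaches the identity. Finally,
  the sections of \<open>st\<^sub>H(1)\<close> are powers of \<open>x\<close> and so do not include \<open>\<sigma>\<close>.\<close>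

interpretation Aut: group AutT2
  by (rule group_AutT2)

lemma mult_AutT2: "g \<otimes>\<^bsub>AutT2\<^esub> h = h \<circ> g"
  by (simp add: AutT2_def)

lemma one_AutT2: "\<one>\<^bsub>AutT2\<^esub> = id"
  by (simp add: AutT2_def)

text \<open>Siblings have distinct images below a common parent, so every local permutation is
  injective on two letters: the identity or \<open>Not\<close>.\<close>

lemma Gamma2_eq_AutT2: "Gamma2 = AutT2"
proof -
  have "\<exists>k. local_perm g v = Not ^^ k" if g: "g \<in> tree_aut" for g v
  proof -
    have "g (v @ [False]) \<noteq> g (v @ [True])"
      using g by (simp add: tree_aut_def bij_is_inj inj_eq)
    then have "local_perm g v False \<noteq> local_perm g v True"
      using tree_aut_snoc[OF g, of v False] tree_aut_snoc[OF g, of v True]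
      by (auto simp: local_perm_def)
    then have "local_perm g v = Not ^^ 0 \<or> local_perm g v = Not ^^ 1"
      by (auto simp: fun_eq_iff all_bool_eq)
    then show ?thesis
      by blast
  qed
  then show ?thesis
    by (auto simp: Gamma2_def AutT2_def)
qed

section \<open>Powers of the adding machine and wreath product coordinates\<close>

definition odometer_pow :: "int \<Rightarrow> bool list \<Rightarrow> bool list" where
  "odometer_pow i = adding_machine [^]\<^bsub>AutT2\<^esub> i"

lemma odometer_pow_closed [simp]: "odometer_pow i \<in> carrier AutT2"
  by (simp add: odometer_pow_def adding_machine_aut)

lemma odometer_pow_tree_aut [simp]: "odometer_pow i \<in> tree_aut"
  using odometer_pow_closed[of i] by (simp add: AutT2_def)

lemma odometer_pow_add: "odometer_pow j \<circ> odometer_pow i = odometer_pow (i + j)"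
  using Aut.int_pow_mult[OF adding_machine_aut, of i j] by (simp add: odometer_pow_def mult_AutT2)

lemma odometer_pow_add_apply: "odometer_pow j (odometer_pow i w) = odometer_pow (i + j) w"
  using fun_cong[OF odometer_pow_add, of j i w] by simp

lemma odometer_pow_0 [simp]: "odometer_pow 0 = id"
  by (simp add: odometer_pow_def one_AutT2)

lemma odometer_pow_1 [simp]: "odometer_pow 1 = adding_machine"
  by (simp add: odometer_pow_def adding_machine_aut)

text \<open>Integer exponents with a flag for the swap turn products and inverses into arithmetic
  that the simplifier can do.\<close>

definition wreath_elt :: "int \<Rightarrow> int \<Rightarrow> bool \<Rightarrow> bool list \<Rightarrow> bool list" where
  "wreath_elt i j s = pair_aut (odometer_pow i) (odometer_pow j) \<otimes>\<^bsub>AutT2\<^esub> (if s then sigma else \<one>\<^bsub>AutT2\<^esub>)"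

lemma wreath_elt_Nil: "wreath_elt i j s [] = []"
  by (simp add: wreath_elt_def mult_AutT2 one_AutT2 pair_aut_def sigma_def)

lemma wreath_elt_Cons:
  "wreath_elt i j s (a # w) = (a \<noteq> s) # odometer_pow (if a then j else i) w"
  by (simp add: wreath_elt_def mult_AutT2 one_AutT2 pair_aut_def sigma_def)

lemma wreath_elt_closed [simp]: "wreath_elt i j s \<in> carrier AutT2"
proof -
  have "pair_aut (odometer_pow i) (odometer_pow j) \<in> carrier AutT2"
    using pair_aut_st1[of "odometer_pow i" "odometer_pow j"] by (simp add: st1_def)
  then show ?thesis
    by (simp add: wreath_elt_def sigma_aut)
qed

text \<open>The left factor acts first, so its swap exchanges the subtrees before \<open>k\<close>
  and \<open>l\<close> are applied.\<close>

lemma wreath_elt_mult [simp]: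
  "wreath_elt i j s \<otimes>\<^bsub>AutT2\<^esub> wreath_elt k l t =
    wreath_elt (i + (if s then l else k)) (j + (if s then k else l)) (s \<noteq> t)"
proof
  fix w
  show "(wreath_elt i j s \<otimes>\<^bsub>AutT2\<^esub> wreath_elt k l t) w =
      wreath_elt (i + (if s then l else k)) (j + (if s then k else l)) (s \<noteq> t) w"
    by (cases w) (auto simp: mult_AutT2 wreath_elt_Nil wreath_elt_Cons odometer_pow_add_apply)
qed

lemma wreath_elt_one: "wreath_elt 0 0 False = \<one>\<^bsub>AutT2\<^esub>"
proof
  fix w show "wreath_elt 0 0 False w = \<one>\<^bsub>AutT2\<^esub> w"
    by (cases w) (auto simp: one_AutT2 wreath_elt_Nil wreath_elt_Cons)
qed

lemma wreath_elt_inv [simp]: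
  "inv\<^bsub>AutT2\<^esub> (wreath_elt i j s) = wreath_elt (- (if s then j else i)) (- (if s then i else j)) s"
  by (rule Aut.inv_equality) (auto simp: wreath_elt_one)

lemma sigma_eq_wreath_elt: "sigma = wreath_elt 0 0 True"
proof
  fix w show "sigma w = wreath_elt 0 0 True w"
    by (cases w) (auto simp: sigma_def wreath_elt_Nil wreath_elt_Cons)
qed

lemma adding_machine_eq_wreath_elt: "adding_machine = wreath_elt 0 1 True"
proof
  fix w show "adding_machine w = wreath_elt 0 1 True w"
    by (cases w) (auto simp: wreath_elt_Nil wreath_elt_Cons)
qed

lemma wreath_elt_mem_st1: "wreath_elt i j s \<in> st1 \<longleftrightarrow> \<not> s"
proof -
  have "odometer_pow k [] = []" for k
    using odometer_pow_tree_aut[of k] by (simp add: tree_aut_def del: odometer_pow_tree_aut)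
  then show ?thesis
    by (auto simp: st1_def wreath_elt_Cons)
qed

section \<open>Infinite order of the adding machine and uniqueness of coordinates\<close>

lemma odometer_pow_double: "odometer_pow (2 * i) = wreath_elt i i False"
proof -
  have nat: "odometer_pow (2 * int n) = wreath_elt (int n) (int n) False" for n
  proof (induction n)
    case 0
    then show ?case by (simp add: wreath_elt_one one_AutT2)
  next
    case (Suc n)
    \<comment> \<open>The last factor is
      \<open>x^2 = (1,x) sigma (1,x) sigma = (1,x)(x,1) = (x,x)\<close>.\<close>
    have "odometer_pow (2 * int (Suc n)) =
        odometer_pow (2 * int n) \<otimes>\<^bsub>AutT2\<^esub> (odometer_pow 1 \<otimes>\<^bsub>AutT2\<^esub> odometer_pow 1)"
      by (simp add: mult_AutT2 odometer_pow_add ac_simps del: odometer_pow_1)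
    then show ?case
      by (simp add: Suc adding_machine_eq_wreath_elt add.commute)
  qed
  show ?thesis
  proof (cases i rule: int_cases2)
    case (nonneg n)
    then show ?thesis by (simp add: nat)
  next
    case (nonpos n)
    have "odometer_pow (2 * i) = inv\<^bsub>AutT2\<^esub> odometer_pow (2 * int n)"
      by (simp add: nonpos odometer_pow_def Aut.int_pow_neg adding_machine_aut)
    then show ?thesis
      by (simp add: nat nonpos)
  qed
qed

lemma section_at_wreath_elt:
  "section_at (wreath_elt i j s) [a] = odometer_pow (if a then j else i)"
  by (simp add: section_at_def wreath_elt_Cons)

lemma odometer_pow_eq_id: "odometer_pow i = id \<longleftrightarrow> i = 0"
proof
  show "odometer_pow i = id \<Longrightarrow> i = 0"
  proof (induction "nat \<bar>i\<bar>" arbitrary: i rule: less_induct)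
    case less
    have "even i"
    proof (rule ccontr)
      \<comment> \<open>An odd power of \<open>x\<close> swaps the two first-level vertices, so it
        is not the identity.\<close>
      assume "odd i"
      then obtain m where m: "i = 2 * m + 1" by (elim oddE)
      have "odometer_pow i = odometer_pow (2 * m) \<otimes>\<^bsub>AutT2\<^esub> odometer_pow 1"
        by (simp only: m mult_AutT2 odometer_pow_add)
      also have "\<dots> = wreath_elt m (m + 1) True"
        by (simp add: odometer_pow_double adding_machine_eq_wreath_elt)
      finally have "wreath_elt m (m + 1) True \<in> st1"
        using less.prems wreath_elt_mem_st1[of 0 0 False] by (simp add: wreath_elt_one one_AutT2)
      then show False
        by (simp add: wreath_elt_mem_st1)
    qed
    then obtain m where m: "i = 2 * m" by (elim evenE)
    \<comment> \<open>Comparing sections halves the exponent, which drives the descent unless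
      \<open>m = 0\<close>.\<close>
    have "wreath_elt m m False = wreath_elt 0 0 False"
      using less.prems by (simp add: m odometer_pow_double wreath_elt_one one_AutT2)
    then have "odometer_pow m = id"
      using section_at_wreath_elt[of m m False True] section_at_wreath_elt[of 0 0 False True] by simp
    then show "i = 0"
      using less.hyps[of m] by (cases "m = 0") (auto simp: m abs_mult)
  qed
qed simp

text \<open>The action on the first level recovers the flag, the sections recover the powers of
  \<open>x\<close>, and infinite order recovers the exponents.\<close>

lemma wreath_elt_eq_iff:
  "wreath_elt i j s = wreath_elt k l t \<longleftrightarrow> i = k \<and> j = l \<and> s = t"
proof
  have pow: "m = n" if "odometer_pow m = odometer_pow n" for m n
  proof -
    have "odometer_pow (m - n) = odometer_pow (- n) \<circ> odometer_pow m"
      by (simp add: odometer_pow_add)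
    also have "\<dots> = id"
      by (simp add: that odometer_pow_add)
    finally show ?thesis
      by (simp add: odometer_pow_eq_id)
  qed
  assume eq: "wreath_elt i j s = wreath_elt k l t"
  then have "s = t"
    using wreath_elt_mem_st1 by metis
  moreover have "odometer_pow (if a then j else i) = odometer_pow (if a then l else k)" for a
    using section_at_wreath_elt[of i j s a] section_at_wreath_elt[of k l t a] eq by simp
  from this[of True] this[of False] have "i = k" "j = l"
    using pow by auto
  ultimately show "i = k \<and> j = l \<and> s = t"
    by simp
qed simp

section \<open>The group generated by \<open>sigma\<close> and the adding machine\<close>

definition wreath_grp :: "(bool list \<Rightarrow> bool list) set" where
  "wreath_grp = {wreath_elt i j s |i j s. True}"

lemma wreath_elt_mem [simp]: "wreath_elt i j s \<in> wreath_grp"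
  by (auto simp: wreath_grp_def)

lemma wreath_grp_cases:
  assumes "g \<in> wreath_grp"
  obtains i j s where "g = wreath_elt i j s"
  using assms by (auto simp: wreath_grp_def)

lemma subgroup_wreath_grp: "subgroup wreath_grp AutT2"
proof
  show "\<one>\<^bsub>AutT2\<^esub> \<in> wreath_grp"
    by (simp flip: wreath_elt_one)
qed (auto elim!: wreath_grp_cases)

lemma generate_eq_wreath_grp: "generate AutT2 {sigma, adding_machine} = wreath_grp"
proof
  show "generate AutT2 {sigma, adding_machine} \<subseteq> wreath_grp"
    by (rule Aut.generate_subgroup_incl[OF _ subgroup_wreath_grp])
      (simp add: sigma_eq_wreath_elt adding_machine_eq_wreath_elt)
  let ?H = "generate AutT2 {sigma, adding_machine}"
  have sub: "subgroup ?H AutT2"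
    by (rule Aut.generate_is_subgroup) (simp add: sigma_aut adding_machine_aut)
  have s: "wreath_elt 0 0 True \<in> ?H"
    unfolding sigma_eq_wreath_elt[symmetric] by (rule generate.incl) simp
  have x: "wreath_elt 0 1 True \<in> ?H"
    unfolding adding_machine_eq_wreath_elt[symmetric] by (rule generate.incl) simp
  \<comment> \<open>This is \<open>x sigma = (1,x)\<close>, which generates the second coordinate of
    the base.\<close>
  have b: "wreath_elt 0 1 False \<in> ?H"
    using subgroup.m_closed[OF sub x s] by simp
  have nat: "wreath_elt 0 (int n) False \<in> ?H" for n
  proof (induction n)
    case 0
    show ?case using subgroup.one_closed[OF sub] by (simp add: wreath_elt_one)
  next
    case (Suc n)
    show ?case using subgroup.m_closed[OF sub Suc b] by (simp add: add.commute)
  qed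
  have right: "wreath_elt 0 j False \<in> ?H" for j
  proof (cases j rule: int_cases2)
    case (nonneg n)
    then show ?thesis by (simp add: nat)
  next
    case (nonpos n)
    then show ?thesis using subgroup.m_inv_closed[OF sub nat[of n]] by simp
  qed
  \<comment> \<open>Moving \<open>sigma\<close> past \<open>(1,x^i)\<close> carries the exponent to
    the first coordinate.\<close>
  have left: "wreath_elt i 0 True \<in> ?H" for i
    using subgroup.m_closed[OF sub s right[of i]] by simp
  have "wreath_elt i j s \<in> ?H" for i j s
  proof (cases s)
    case True
    then show ?thesis using subgroup.m_closed[OF sub right[of j] left[of i]] by simp
  next
    case False
    have "wreath_elt i j True \<in> ?H"
      using subgroup.m_closed[OF sub right[of j] left[of i]] by simp
    then show ?thesis using subgroup.m_closed[OF sub _ s] False by fastforce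
  qed
  then show "wreath_grp \<subseteq> ?H"
    by (auto simp: wreath_grp_def)
qed

lemma st1_Int_wreath_grp: "st1 \<inter> wreath_grp = {wreath_elt i j False |i j. True}"
proof
  show "st1 \<inter> wreath_grp \<subseteq> {wreath_elt i j False |i j. True}"
  proof
    fix g assume "g \<in> st1 \<inter> wreath_grp"
    then obtain i j s where g: "g = wreath_elt i j s" and "wreath_elt i j s \<in> st1"
      by (auto simp: wreath_grp_def)
    then have "\<not> s" by (simp add: wreath_elt_mem_st1)
    then show "g \<in> {wreath_elt i j False |i j. True}"
      using g by auto
  qed
qed (auto simp: wreath_elt_mem_st1)

lemma not_fractal_wreath_grp: "\<not> fractal wreath_grp"
proof
  assume "fractal wreath_grp"
  then have "sigma \<in> fst ` psi ` (st1 \<inter> wreath_grp)"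
    by (simp add: fractal_def sigma_eq_wreath_elt)
  then obtain i where sigma: "sigma = odometer_pow i"
    by (auto simp: st1_Int_wreath_grp psi_def section_at_wreath_elt)
  \<comment> \<open>As a power of \<open>x\<close>, \<open>sigma\<close> would commute with
    \<open>x\<close>, but \<open>sigma x = (x,1)\<close> and \<open>x sigma = (1,x)\<close>.\<close>
  have "odometer_pow i \<otimes>\<^bsub>AutT2\<^esub> odometer_pow 1 = odometer_pow 1 \<otimes>\<^bsub>AutT2\<^esub> odometer_pow i"
    by (simp only: mult_AutT2 odometer_pow_add add.commute)
  then show False
    unfolding odometer_pow_1 sigma[symmetric]
    by (simp add: sigma_eq_wreath_elt adding_machine_eq_wreath_elt wreath_elt_eq_iff)
qed

section \<open>Derived subgroups and their index\<close>

lemma derived_st1_Int_wreath_grp: "derived AutT2 (st1 \<inter> wreath_grp) = {\<one>\<^bsub>AutT2\<^esub>}"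
proof -
  have "g \<otimes>\<^bsub>AutT2\<^esub> h \<otimes>\<^bsub>AutT2\<^esub> inv\<^bsub>AutT2\<^esub> g \<otimes>\<^bsub>AutT2\<^esub> inv\<^bsub>AutT2\<^esub> h = \<one>\<^bsub>AutT2\<^esub>"
    if "g \<in> st1 \<inter> wreath_grp" "h \<in> st1 \<inter> wreath_grp" for g h
    using that by (auto simp: st1_Int_wreath_grp wreath_elt_one)
  then have "derived_set AutT2 (st1 \<inter> wreath_grp) \<subseteq> {\<one>\<^bsub>AutT2\<^esub>}"
    by (intro UN_least) simp
  then have "derived AutT2 (st1 \<inter> wreath_grp) \<subseteq> {\<one>\<^bsub>AutT2\<^esub>}"
    unfolding derived_def by (rule Aut.generate_subgroup_incl[OF _ Aut.triv_subgroup])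
  then show ?thesis
    using generate.one[of AutT2] by (auto simp: derived_def)
qed

lemma infinite_derived_wreath_grp: "infinite (derived AutT2 wreath_grp)"
proof -
  have "wreath_elt i (- i) False \<in> derived AutT2 wreath_grp" for i
  proof -
    \<comment> \<open>The generators of \<open>derived\<close> have the form
      \<open>g h g^-1 h^-1\<close>, unlike \<open>commutator\<close>; here
      \<open>g = (x^i,1)\<close> and \<open>h = sigma\<close>.\<close>
    have "wreath_elt i (- i) False =
        wreath_elt i 0 False \<otimes>\<^bsub>AutT2\<^esub> wreath_elt 0 0 True
        \<otimes>\<^bsub>AutT2\<^esub> inv\<^bsub>AutT2\<^esub> wreath_elt i 0 False \<otimes>\<^bsub>AutT2\<^esub> inv\<^bsub>AutT2\<^esub> wreath_elt 0 0 True"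
      by simp
    then show ?thesis
      unfolding derived_def using wreath_elt_mem by (blast intro: generate.incl)
  qed
  then have "range (\<lambda>i. wreath_elt i (- i) False) \<subseteq> derived AutT2 wreath_grp"
    by blast
  moreover have "infinite (range (\<lambda>i. wreath_elt i (- i) False))"
    using infinite_UNIV_int by (auto dest!: finite_imageD intro!: injI simp: wreath_elt_eq_iff)
  ultimately show ?thesis
    by (rule infinite_super)
qed

text \<open>Cosets of the trivial subgroup are singletons, so there are as many as elements of
  \<open>A\<close>.\<close>

lemma (in group) infinite_index_trivial:
  assumes "subgroup A G" "infinite A"
  shows "infinite_index G A {\<one>}"
proof -
  interpret A: group "G\<lparr>carrier := A\<rparr>"
    by (rule subgroup.subgroup_is_group[OF assms(1) is_group])
  have "(\<lambda>a. {a}) ` A \<subseteq> rcosets\<^bsub>G\<lparr>carrier := A\<rparr>\<^esub> {\<one>}"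
  proof clarify
    fix a assume a: "a \<in> A"
    then have "{a} = {\<one>} #>\<^bsub>G\<lparr>carrier := A\<rparr>\<^esub> a"
      using subgroup.mem_carrier[OF assms(1)] by (simp add: r_coset_def)
    then show "{a} \<in> rcosets\<^bsub>G\<lparr>carrier := A\<rparr>\<^esub> {\<one>}"
      using a by (auto simp: RCOSETS_def)
  qed
  moreover have "infinite ((\<lambda>a. {a}) ` A)"
    using assms(2) by (simp add: finite_image_iff)
  ultimately have "infinite (rcosets\<^bsub>G\<lparr>carrier := A\<rparr>\<^esub> {\<one>})"
    by (rule infinite_super)
  then show ?thesis
    using A.triv_subgroup by (simp add: infinite_index_def)
qed

lemma infinite_index_wreath_grp:
  "infinite_index AutT2 (derived AutT2 wreath_grp) (derived AutT2 (st1 \<inter> wreath_grp))"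
  unfolding derived_st1_Int_wreath_grp
  by (intro Aut.infinite_index_trivial infinite_derived_wreath_grp Aut.derived_is_subgroup
      subgroup.subset[OF subgroup_wreath_grp])

section \<open>Left Engel elements\<close>

lemma commutator_wreath_grp:
  "commutator (AutT2\<lparr>carrier := wreath_grp\<rparr>) (wreath_elt i j s) (wreath_elt k l t) =
    inv\<^bsub>AutT2\<^esub> wreath_elt i j s \<otimes>\<^bsub>AutT2\<^esub> inv\<^bsub>AutT2\<^esub> wreath_elt k l t
    \<otimes>\<^bsub>AutT2\<^esub> wreath_elt i j s \<otimes>\<^bsub>AutT2\<^esub> wreath_elt k l t"
  \<comment> \<open>Inverses in the subgroup agree with those in \<open>AutT2\<close>, so the
    coordinate rules become applicable to Engel commutators.\<close>
  by (simp add: commutator_def Aut.m_inv_consistent[OF subgroup_wreath_grp] del: wreath_elt_mult wreath_elt_inv)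

lemma left_engel_wreath_grp:
  "left_engel_elements (AutT2\<lparr>carrier := wreath_grp\<rparr>) = st1 \<inter> wreath_grp" (is "?L = _")
proof
  let ?H = "AutT2\<lparr>carrier := wreath_grp\<rparr>"
  show "st1 \<inter> wreath_grp \<subseteq> ?L"
  proof
    fix g assume "g \<in> st1 \<inter> wreath_grp"
    then obtain k l where g: "g = wreath_elt k l False"
      by (auto simp: st1_Int_wreath_grp)
    \<comment> \<open>The base is normal, so the first commutator lies in it; the base is abelian,
      so the second one vanishes.\<close>
    have "engel_commutator ?H h 2 g = \<one>\<^bsub>AutT2\<^esub>" if "h \<in> wreath_grp" for h
      using that
      by (auto elim!: wreath_grp_cases
          simp: g numeral_2_eq_2 commutator_wreath_grp wreath_elt_one[symmetric] wreath_elt_eq_iff)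
    then show "g \<in> ?L"
      unfolding left_engel_elements_def by (auto simp: g intro!: exI[of _ 2])
  qed
  show "?L \<subseteq> st1 \<inter> wreath_grp"
  proof
    fix g assume L: "g \<in> ?L"
    then have "g \<in> wreath_grp"
      by (simp add: left_engel_elements_def)
    then obtain k l t where g: "g = wreath_elt k l t"
      by (rule wreath_grp_cases)
    have "\<not> t"
    proof
      assume t
      \<comment> \<open>Conjugation by \<open>g\<close> inverts \<open>(x^c,x^-c)\<close> whatever
        \<open>k\<close> and \<open>l\<close> are, so each commutation multiplies \<open>c\<close>
        by -2.\<close>
      have engel: "engel_commutator ?H (wreath_elt 1 (- 1) False) n g =
          wreath_elt ((- 2) ^ n) (- ((- 2) ^ n)) False" for n
        by (induction n) (simp_all add: g \<open>t\<close> commutator_wreath_grp wreath_elt_eq_iff)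
      obtain n where "engel_commutator ?H (wreath_elt 1 (- 1) False) n g = \<one>\<^bsub>AutT2\<^esub>"
        using L unfolding left_engel_elements_def by fastforce
      then show False
        by (simp add: engel wreath_elt_one[symmetric] wreath_elt_eq_iff)
    qed
    then show "g \<in> st1 \<inter> wreath_grp"
      by (simp add: g wreath_elt_mem_st1)
  qed
qed

theorem proposition13:
  fixes H :: "(bool list \<Rightarrow> bool list) set"
  assumes "H = generate AutT2 {sigma, adding_machine}"
  shows "subgroup H Gamma2 \<and> Gamma2 = AutT2 \<and>
    \<not> fractal H \<and>
    infinite_index AutT2 (derived AutT2 H) (derived AutT2 (st1 \<inter> H)) \<and>
    left_engel_elements (AutT2\<lparr>carrier := H\<rparr>) = st1 \<inter> H"
  unfolding assms generate_eq_wreath_grp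
  using Gamma2_eq_AutT2 subgroup_wreath_grp not_fractal_wreath_grp infinite_index_wreath_grp
    left_engel_wreath_grp by simp

end
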